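(* Assume the following. (i) $\mathbb E\,\psi(0,Y)<\infty$ and, for all $F\in L^2(\mu_X)$, there exists $\delta>0$ such that $$\sup_{G\in L^2(\mu_X):\,\|G-F\|_{\mu_X}\le\delta}\big(\mathbb E|\partial_x^-\psi(G(X),Y)|^2+\mathbb E|\partial_x^+\psi(G(X),Y)|^2\big)<\infty .$$ (ii) There exists $\alpha>0$ such that, for all $y\in\mathcal Y$, $\psi(\cdot,y)$ is $\alpha$-strongly convex: for all $(x_1,x_2)\in\mathbb R^2$ and $t\in[0,1]$, $$\psi(tx_1+(1-t)x_2,y)\le t\psi(x_1,y)+(1-t)\psi(x_2,y)-\frac{\alpha}{2}t(1-t)(x_1-x_2)^2 .$$ (iii) There exists a constant $L>0$ such that, for all $(x_1,x_2)\in\mathbb R^2$, $|\mathbb E(\xi(x_1,Y)-\xi(x_2,Y)\mid X)|\le L|x_1-x_2|$. Let $(F_t)_{t\ge0}$ be produced by Algorithm 2 (described in the context) with $0<\nu<1/(2L)$. Then $$\lim_{t\to\infty}C(F_t)=\inf_{F\in\mathrm{lin}(\mathcal P)}C(F).$$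
   Context: $\mathcal X$ is a Borel subset of $\mathbb R^d$ and $\mathcal Y\subset\mathbb R$ (a finite set of labels, or a general subset of $\mathbb R$). $(X,Y)$ is a random pair in $\mathcal X\times\mathcal Y$ with arbitrary distribution $\mu_{X,Y}$; $\mu_X$ is the law of $X$; $L^2(\mu_X)$ is the space of measurable $f:\mathcal X\to\mathbb R$ with $\int|f|^2\,d\mu_X<\infty$, with norm $\|\cdot\|_{\mu_X}$. The loss $\psi:\mathbb R\times\mathcal Y\to[0,\infty)$ is measurable and convex in its first argument; $\partial_x^-\psi,\partial_x^+\psi$ are its left and right partial derivatives in the first argument, and $\xi(\cdot,y)$ is a fixed choice of subgradient of $\psi(\cdot,y)$, i.e. $\xi(x,y)\in[\partial_x^-\psi(x,y),\partial_x^+\psi(x,y)]$, with $\xi$ measurable. The risk functional is $C(F)=\mathbb E\,\psi(F(X),Y)$. $\mathcal P\subset L^2(\mu_X)$ is a (nonempty) class of functions such that $f\in\mathcal P\Leftrightarrow -f\in\mathcal P$ and $af\in\mathcal P$ for all $(a,f)\in\mathbb R\times\mathcal P$ (in particular $0\in\mathcal P$). $\mathrm{lin}(\mathcal P)$ is the set of all finite linear combinations of elements of $\mathcal P$. Algorithm 2 with step size $\nu>0$: start with $F_0\in\mathcal P$; for $t=0,1,2,\dots$ choose $$f_{t+1}\in\arg\min_{f\in\mathcal P}\big(2\,\mathbb E\,\xi(F_t(X),Y)f(X)+\|f\|_{\mu_X}^2\big)$$ (the minimum is assumed to be attained) and set $F_{t+1}=F_t+\nu f_{t+1}$. The algorithm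 is run forever. *)

theory Defs
  imports "HOL-Probability.Probability"
begin

definition left_deriv :: "(real \<Rightarrow> real) \<Rightarrow> real \<Rightarrow> real" where
  "left_deriv g x = (THE D. (g has_real_derivative D) (at_left x))"

definition right_deriv :: "(real \<Rightarrow> real) \<Rightarrow> real \<Rightarrow> real" where
  "right_deriv g x = (THE D. (g has_real_derivative D) (at_right x))"

definition strongly_convex :: "real \<Rightarrow> (real \<Rightarrow> real) \<Rightarrow> bool" where
  "strongly_convex \<alpha> g \<longleftrightarrow>
     (\<forall>x1 x2. \<forall>t\<in>{0..1}. g (t * x1 + (1 - t) * x2)
        \<le> t * g x1 + (1 - t) * g x2 - \<alpha> / 2 * t * (1 - t) * (x1 - x2)\<^sup>2)"

(* Elements are functions, not classes modulo almost-everywhere equality, so L2_norm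
   is only a seminorm on L2_space. *)
definition L2_space :: "'a measure \<Rightarrow> ('a \<Rightarrow> real) set" where
  "L2_space N = {f \<in> borel_measurable N. integrable N (\<lambda>x. (f x)\<^sup>2)}"

definition L2_norm :: "'a measure \<Rightarrow> ('a \<Rightarrow> real) \<Rightarrow> real" where
  "L2_norm N f = sqrt (\<integral>x. (f x)\<^sup>2 \<partial>N)"

definition lin :: "('a \<Rightarrow> real) set \<Rightarrow> ('a \<Rightarrow> real) set" where
  "lin P = {F. \<exists>(n::nat) c f. (\<forall>i<n. f i \<in> P) \<and> F = (\<lambda>x. \<Sum>i<n. c i * f i x)}"

(* Valued in ennreal, so an infinite expectation is represented as infinity. The encoding
   is faithful for losses that are nonnegative on the range of Y. *)
definition risk ::
  "'w measure \<Rightarrow> ('w \<Rightarrow> 'x) \<Rightarrow> ('w \<Rightarrow> real) \<Rightarrow> (real \<Rightarrow> real \<Rightarrow> real) \<Rightarrow> ('x \<Rightarrow> real) \<Rightarrow> ennreal" where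
  "risk M X Y \<psi> F = (\<integral>\<^sup>+\<omega>. ennreal (\<psi> (F (X \<omega>)) (Y \<omega>)) \<partial>M)"

definition boosting_objective ::
  "'w measure \<Rightarrow> 'x measure \<Rightarrow> ('w \<Rightarrow> 'x) \<Rightarrow> ('w \<Rightarrow> real) \<Rightarrow> (real \<Rightarrow> real \<Rightarrow> real) \<Rightarrow>
   ('x \<Rightarrow> real) \<Rightarrow> ('x \<Rightarrow> real) \<Rightarrow> real" where
  "boosting_objective M \<mu> X Y \<xi> F f =
     2 * (\<integral>\<omega>. \<xi> (F (X \<omega>)) (Y \<omega>) * f (X \<omega>) \<partial>M) + (L2_norm \<mu> f)\<^sup>2"

(* F is the sequence of iterates and f the sequence of minimizers chosen at each step;
   f 0 plays no role. *)
definition boosting_run ::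
  "'w measure \<Rightarrow> 'x measure \<Rightarrow> ('w \<Rightarrow> 'x) \<Rightarrow> ('w \<Rightarrow> real) \<Rightarrow> (real \<Rightarrow> real \<Rightarrow> real) \<Rightarrow>
   ('x \<Rightarrow> real) set \<Rightarrow> real \<Rightarrow> (nat \<Rightarrow> 'x \<Rightarrow> real) \<Rightarrow> (nat \<Rightarrow> 'x \<Rightarrow> real) \<Rightarrow> bool" where
  "boosting_run M \<mu> X Y \<xi> P \<nu> F f \<longleftrightarrow>
     F 0 \<in> P \<and>
     (\<forall>t. is_arg_min (boosting_objective M \<mu> X Y \<xi> (F t)) (\<lambda>g. g \<in> P) (f (Suc t)) \<and>
          F (Suc t) = (\<lambda>x. F t x + \<nu> * f (Suc t) x))"

end

theory Submission
  imports Defs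
begin

text \<open>Write \<open>C\<close> for the risk and \<open>\<Lambda>\<^sub>t g = E \<xi> (F\<^sub>t X) Y * g X\<close> for the action on \<open>g\<close> of the
subgradient of \<open>C\<close> at the iterate \<open>F\<^sub>t\<close>. The algorithm is a greedy subgradient
descent, and the argument has three ingredients.

Optimality of the weak learner. Since \<open>P\<close> is a cone, minimality of \<open>f\<^sub>t\<^sub>+\<^sub>1\<close> can be tested along
lines. It yields \<open>\<Lambda>\<^sub>t f\<^sub>t\<^sub>+\<^sub>1 = - \<parallel>f\<^sub>t\<^sub>+\<^sub>1\<parallel>\<^sup>2\<close> and \<open>\<bar>\<Lambda>\<^sub>t g\<bar> \<le> \<parallel>g\<parallel> * \<parallel>f\<^sub>t\<^sub>+\<^sub>1\<parallel>\<close> for all \<open>g\<close> in \<open>P\<close>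
(\<open>weak_learner_optimality\<close>). So the norm of the weak learner measures how far \<open>F\<^sub>t\<close> is from
being stationary in the directions of \<open>P\<close>.

Descent. Convexity and the conditional Lipschitz property of \<open>\<xi>\<close> give
\<open>C (F\<^sub>t\<^sub>+\<^sub>1) \<le> C F\<^sub>t - \<nu> * (1 - \<nu> * L) * \<parallel>f\<^sub>t\<^sub>+\<^sub>1\<parallel>\<^sup>2\<close> (\<open>mean_loss_descent\<close>).
The step size makes the factor positive, hence \<open>C F\<^sub>t\<close> decreases and the squares
\<open>\<parallel>f\<^sub>t\<parallel>\<^sup>2\<close> are summable. The Lipschitz property is assumed at deterministic points only;
\<open>increment_bound\<close> extends it to the random points \<open>F\<^sub>t X\<close> and \<open>F\<^sub>t\<^sub>+\<^sub>1 X\<close>, using that \<open>\<xi>\<close> is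
nondecreasing in its first argument.

Comparison with a competitor. For \<open>G\<close> in the span of \<open>P\<close>, convexity gives
\<open>C F\<^sub>t \<le> C G - \<Lambda>\<^sub>t (G - F\<^sub>t)\<close>. Expanding \<open>G\<close> and \<open>F\<^sub>t = F\<^sub>0 + \<nu> * (f\<^sub>1 + \<dots> + f\<^sub>t)\<close> into elements of \<open>P\<close> bounds
the last term by \<open>\<parallel>f\<^sub>t\<^sub>+\<^sub>1\<parallel> * (K + \<nu> * (\<parallel>f\<^sub>1\<parallel> + \<dots> + \<parallel>f\<^sub>t\<parallel>))\<close> with \<open>K\<close> depending only on \<open>G\<close> and \<open>F\<^sub>0\<close>.
Although the sum of norms may diverge, this product becomes arbitrarily small for suitable \<open>t\<close>, because the
norms are square-summable (\<open>square_summable_times_partial_sums_small\<close>). One such \<open>t\<close> for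
each tolerance is enough, since the risk is monotone along the run (\<open>boosting_risk_tendsto\<close>).\<close>

section \<open>Two elementary facts on reals and sequences\<close>

text \<open>Applied to the boosting objective along a line, this turns minimality over a cone into an
inequality of Cauchy--Schwarz type for the subgradient of the risk.\<close>

lemma quadratic_nonneg_imp_discriminant_le:
  fixes N B C :: real
  assumes "N \<ge> 0" and nonneg: "\<And>s. 0 \<le> s\<^sup>2 * N + 2 * s * B + C"
  shows "B\<^sup>2 \<le> N * C"
proof (cases "N = 0")
  case True
  have "B = 0"
  proof (rule ccontr)
    assume "B \<noteq> 0"
    then show False
      using nonneg[of "- (C + 1) / (2 * B)"] True by (simp add: field_simps)
  qed
  then show ?thesis using True by simp
next
  case False
  with assms(1) have "N > 0" by simp
  have "N * ((- B / N)\<^sup>2 * N + 2 * (- B / N) * B + C) = N * C - B\<^sup>2"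
    using False by (simp add: field_simps power2_eq_square)
  moreover have "0 \<le> N * ((- B / N)\<^sup>2 * N + 2 * (- B / N) * B + C)"
    using nonneg[of "- B / N"] \<open>N > 0\<close> by (intro mult_nonneg_nonneg) auto
  ultimately show ?thesis by simp
qed

text \<open>By Cauchy--Schwarz the partial sums of a square-summable sequence grow at most like $\sqrt t$.
If the products stayed above \<open>\<epsilon>\<close>, then \<open>(a t)\<^sup>2\<close> would dominate a multiple of the harmonic series.\<close>

lemma square_summable_times_partial_sums_small:
  fixes a :: "nat \<Rightarrow> real"
  assumes nonneg: "\<And>t. 0 \<le> a t" and sq: "summable (\<lambda>t. (a t)\<^sup>2)"
    and "0 \<le> K" "0 \<le> \<nu>" "0 < \<epsilon>"
  shows "\<exists>t\<ge>T. a t * (K + \<nu> * (\<Sum>s<t. a s)) < \<epsilon>"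
proof (rule ccontr)
  assume "\<not> ?thesis"
  then have large: "\<epsilon> \<le> a t * (K + \<nu> * (\<Sum>s<t. a s))" if "t \<ge> T" for t
    using that by force
  define A where "A = (\<Sum>t. (a t)\<^sup>2)"
  define B where "B = 2 * K\<^sup>2 + 2 * \<nu>\<^sup>2 * A + 1"
  have "A \<ge> 0" unfolding A_def using sq by (intro suminf_nonneg) auto
  then have "B > 0" unfolding B_def by (simp add: add_nonneg_pos)
  \<comment> \<open>The summand 1 in \<open>B\<close> only serves to keep the later denominator positive.\<close>
  have bound: "(K + \<nu> * (\<Sum>s<t. a s))\<^sup>2 \<le> B * real (Suc t)" for t
  proof -
    have "(\<Sum>s<t. a s)\<^sup>2 \<le> (\<Sum>s<t. (a s)\<^sup>2) * real t"
      using sum_squared_le_sum_of_squares[of a "{..<t}"] by simp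
    also have "\<dots> \<le> A * real t"
      unfolding A_def using sq by (intro mult_right_mono sum_le_suminf) auto
    finally have S: "(\<Sum>s<t. a s)\<^sup>2 \<le> A * real t" .
    have "(K + \<nu> * (\<Sum>s<t. a s))\<^sup>2 \<le> 2 * K\<^sup>2 + 2 * (\<nu> * (\<Sum>s<t. a s))\<^sup>2"
      by (smt (verit) sum_squares_bound power2_sum)
    also have "\<dots> \<le> 2 * K\<^sup>2 + 2 * (\<nu>\<^sup>2 * (A * real t))"
      using mult_left_mono[OF S, of "\<nu>\<^sup>2"] by (simp add: power_mult_distrib)
    also have "\<dots> \<le> B * real (Suc t)"
      using \<open>A \<ge> 0\<close> unfolding B_def by (simp add: algebra_simps)
    finally show ?thesis .
  qed
  have harm: "\<epsilon>\<^sup>2 / B * inverse (real (Suc t)) \<le> (a t)\<^sup>2" if "t \<ge> T" for t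
  proof -
    have "\<epsilon>\<^sup>2 \<le> (a t)\<^sup>2 * (K + \<nu> * (\<Sum>s<t. a s))\<^sup>2"
      using power_mono[OF large[OF that], of 2] \<open>0 < \<epsilon>\<close> by (simp add: power_mult_distrib)
    also have "\<dots> \<le> (a t)\<^sup>2 * (B * real (Suc t))"
      by (intro mult_left_mono bound) auto
    finally have "\<epsilon>\<^sup>2 / (B * real (Suc t)) \<le> (a t)\<^sup>2"
      using \<open>B > 0\<close> by (subst pos_divide_le_eq) auto
    then show ?thesis by (simp add: divide_inverse mult.assoc)
  qed
  have "summable (\<lambda>t. \<epsilon>\<^sup>2 / B * inverse (real (Suc t)))"
    by (rule summable_comparison_test'[OF sq, of T]) (use harm \<open>B > 0\<close> in auto)
  then have "summable (\<lambda>t. inverse (real (Suc t)))"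
    using summable_mult_D[of "\<epsilon>\<^sup>2 / B"] \<open>B > 0\<close> \<open>0 < \<epsilon>\<close> by fastforce
  then have "summable (\<lambda>t. inverse (real t))"
    by (subst (asm) summable_Suc_iff)
  then show False using not_summable_harmonic by blast
qed

section \<open>One-sided derivatives of a convex function\<close>

lemma convex_secant_slope_mono:
  fixes g :: "real \<Rightarrow> real"
  assumes g: "convex_on UNIV g" and "y \<noteq> x" "z \<noteq> x" "y \<le> z"
  shows "(g y - g x) / (y - x) \<le> (g z - g x) / (z - x)"
proof -
  consider "y = z" | "x < y" "y < z" | "y < x" "x < z" | "y < z" "z < x"
    using assms by linarith
  then show ?thesis
  proof cases
    case 2
    then show ?thesis using convex_on_slope_le(1)[OF g, of x z y]
      by (metis UNIV_I minus_diff_eq minus_divide_divide)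
  next
    case 3
    then show ?thesis using convex_on_slope_le[OF g, of y z x]
      by (smt (verit) UNIV_I minus_diff_eq minus_divide_divide)
  next
    case 4
    then show ?thesis using convex_on_slope_le(2)[OF g, of y x z] by simp
  qed simp
qed

text \<open>The secant slopes from \<open>x\<close> decrease as the second point tends to \<open>x\<close> from the right, and the
slope at any point to the left of \<open>x\<close> bounds them below; hence they converge to their infimum.
This makes the description in the definition of \<open>right_deriv\<close> a genuine limit.\<close>

lemma has_right_deriv:
  fixes g :: "real \<Rightarrow> real"
  assumes g: "convex_on UNIV g"
  shows "((\<lambda>y. (g y - g x) / (y - x)) \<longlongrightarrow> right_deriv g x) (at_right x)"
    and "y > x \<Longrightarrow> right_deriv g x \<le> (g y - g x) / (y - x)"
proof -
  define s where "s = (\<lambda>y. (g y - g x) / (y - x))"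
  define D where "D = Inf (s ` {x<..})"
  have mono: "s y \<le> s z" if "y \<noteq> x" "z \<noteq> x" "y \<le> z" for y z
    using convex_secant_slope_mono[OF g that] by (simp add: s_def)
  have bdd: "bdd_below (s ` {x<..})"
    by (rule bdd_belowI2[of _ "s (x - 1)"]) (auto intro: mono)
  have D_le: "D \<le> s y" if "y > x" for y
    unfolding D_def using bdd that by (intro cInf_lower) auto
  have lim: "(s \<longlongrightarrow> D) (at_right x)"
  proof (rule order_tendstoI)
    fix a assume "a < D"
    then show "\<forall>\<^sub>F y in at_right x. a < s y"
      by (intro eventually_at_right_less[THEN eventually_mono]) (use D_le in force)
  next
    fix a assume "D < a"
    then obtain y where y: "x < y" "s y < a"
      unfolding D_def using cInf_lessD[of "s ` {x<..}" a] by auto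
    have "\<forall>\<^sub>F z in at_right x. z \<in> {x<..<y}"
      using y by (intro eventually_at_right_real) auto
    then show "\<forall>\<^sub>F z in at_right x. s z < a"
      by eventually_elim (use y mono[of _ y] in force)
  qed
  have "right_deriv g x = D"
    unfolding right_deriv_def
  proof (rule the_equality)
    show "(g has_real_derivative D) (at_right x)"
      using lim by (simp add: has_field_derivative_iff s_def)
    fix D' assume "(g has_real_derivative D') (at_right x)"
    then have "(s \<longlongrightarrow> D') (at_right x)"
      by (simp add: has_field_derivative_iff s_def)
    then show "D' = D" using lim tendsto_unique trivial_limit_at_right_real by blast
  qed
  then show "((\<lambda>y. (g y - g x) / (y - x)) \<longlongrightarrow> right_deriv g x) (at_right x)"
    and "y > x \<Longrightarrow> right_deriv g x \<le> (g y - g x) / (y - x)"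
    using lim D_le by (simp_all add: s_def)
qed

lemma convex_on_reflect:
  fixes g :: "real \<Rightarrow> real"
  assumes "convex_on UNIV g"
  shows "convex_on UNIV (\<lambda>u. g (- u))"
  unfolding convex_on_def
proof (intro conjI ballI allI impI)
  fix x y u v :: real assume "0 \<le> u" "0 \<le> v" "u + v = 1"
  then have "g (u *\<^sub>R (- x) + v *\<^sub>R (- y)) \<le> u * g (- x) + v * g (- y)"
    using assms unfolding convex_on_def by blast
  then show "g (- (u *\<^sub>R x + v *\<^sub>R y)) \<le> u * g (- x) + v * g (- y)"
    by (simp add: algebra_simps)
qed simp

text \<open>Reflection of the real line transfers everything known about right derivatives to left ones.\<close>

lemma left_deriv_reflect: "left_deriv g x = - right_deriv (\<lambda>u. g (- u)) (- x)"
  if g: "convex_on UNIV g" for g :: "real \<Rightarrow> real"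
proof -
  define D where "D = right_deriv (\<lambda>u. g (- u)) (- x)"
  have eq: "(\<lambda>y. (g y - g x) / (y - x)) = (\<lambda>y. - ((g (- (- y)) - g (- (- x))) / (- y - (- x))))"
  proof
    fix y show "(g y - g x) / (y - x) = - ((g (- (- y)) - g (- (- x))) / (- y - (- x)))"
      using minus_divide_right[of "g y - g x" "x - y"] by simp
  qed
  have "((\<lambda>y. (g (- y) - g (- (- x))) / (y - (- x))) \<longlongrightarrow> D) (at_right (- x))"
    using has_right_deriv(1)[OF convex_on_reflect[OF g], of "- x"] by (simp add: D_def)
  then have "((\<lambda>y. - ((g (- y) - g (- (- x))) / (y - (- x)))) \<longlongrightarrow> - D) (at_right (- x))"
    by (rule tendsto_minus)
  then have lim: "((\<lambda>y. (g y - g x) / (y - x)) \<longlongrightarrow> - D) (at_left x)"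
    by (subst eq, subst filterlim_at_left_to_right) simp
  show ?thesis
    unfolding left_deriv_def D_def[symmetric]
  proof (rule the_equality)
    show "(g has_real_derivative - D) (at_left x)"
      using lim by (simp add: has_field_derivative_iff)
    fix D' assume "(g has_real_derivative D') (at_left x)"
    then have "((\<lambda>y. (g y - g x) / (y - x)) \<longlongrightarrow> D') (at_left x)"
      by (simp add: has_field_derivative_iff)
    then show "D' = - D" using lim tendsto_unique trivial_limit_at_left_real by blast
  qed
qed

lemma left_deriv_ge:
  fixes g :: "real \<Rightarrow> real"
  assumes g: "convex_on UNIV g" and "y < x"
  shows "(g y - g x) / (y - x) \<le> left_deriv g x"
proof -
  have "right_deriv (\<lambda>u. g (- u)) (- x) \<le> (g y - g x) / (x - y)"
    using has_right_deriv(2)[OF convex_on_reflect[OF g], of "- x" "- y"] \<open>y < x\<close> by simp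
  then show ?thesis
    by (simp add: left_deriv_reflect[OF g]) (metis minus_diff_eq minus_divide_right neg_le_iff_le)
qed

lemma subgradient_inequality:
  fixes g :: "real \<Rightarrow> real"
  assumes g: "convex_on UNIV g" and \<xi>: "\<xi> \<in> {left_deriv g x .. right_deriv g x}"
  shows "g x + \<xi> * (y - x) \<le> g y"
proof (cases x y rule: linorder_cases)
  case less
  then have "\<xi> \<le> (g y - g x) / (y - x)" using has_right_deriv(2)[OF g less] \<xi> by simp
  then show ?thesis using less by (simp add: field_simps)
next
  case greater
  then have "(g y - g x) / (y - x) \<le> \<xi>" using left_deriv_ge[OF g greater] \<xi> by simp
  then show ?thesis using greater by (simp add: field_simps)
qed simp

text \<open>Convexity makes the right derivative the limit of the difference quotients with increments
\<open>1 / (n + 1)\<close>, each of which is measurable.\<close>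

lemma measurable_right_deriv:
  fixes g :: "'a \<Rightarrow> real \<Rightarrow> real"
  assumes g: "\<And>\<omega>. \<omega> \<in> space M \<Longrightarrow> convex_on UNIV (g \<omega>)"
    and meas: "\<And>c. (\<lambda>\<omega>. g \<omega> (u \<omega> + c)) \<in> borel_measurable M"
  shows "(\<lambda>\<omega>. right_deriv (g \<omega>) (u \<omega>)) \<in> borel_measurable M"
proof (rule borel_measurable_LIMSEQ_real)
  fix \<omega> assume "\<omega> \<in> space M"
  have lim: "LIM n sequentially. u \<omega> + inverse (real (Suc n)) :> at_right (u \<omega>)"
    unfolding filterlim_at using LIMSEQ_inverse_real_of_nat_add[of "u \<omega>"] by simp
  show "(\<lambda>n. (g \<omega> (u \<omega> + inverse (real (Suc n))) - g \<omega> (u \<omega> + 0)) / inverse (real (Suc n)))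
      \<longlonglongrightarrow> right_deriv (g \<omega>) (u \<omega>)"
    using filterlim_compose[OF has_right_deriv(1)[OF g[OF \<open>\<omega> \<in> space M\<close>]] lim] by simp
next
  fix n show "(\<lambda>\<omega>. (g \<omega> (u \<omega> + inverse (real (Suc n))) - g \<omega> (u \<omega> + 0)) / inverse (real (Suc n)))
      \<in> borel_measurable M"
    by (intro borel_measurable_divide borel_measurable_diff meas) simp
qed

lemma measurable_left_deriv:
  fixes g :: "'a \<Rightarrow> real \<Rightarrow> real"
  assumes g: "\<And>\<omega>. \<omega> \<in> space M \<Longrightarrow> convex_on UNIV (g \<omega>)"
    and meas: "\<And>c. (\<lambda>\<omega>. g \<omega> (u \<omega> + c)) \<in> borel_measurable M"
  shows "(\<lambda>\<omega>. left_deriv (g \<omega>) (u \<omega>)) \<in> borel_measurable M"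
proof -
  have "(\<lambda>\<omega>. right_deriv (\<lambda>x. g \<omega> (- x)) (- u \<omega>)) \<in> borel_measurable M"
    using meas[of "- c" for c] by (intro measurable_right_deriv convex_on_reflect g) simp_all
  then have "(\<lambda>\<omega>. - right_deriv (\<lambda>x. g \<omega> (- x)) (- u \<omega>)) \<in> borel_measurable M" by simp
  then show ?thesis
    by (subst measurable_cong[OF left_deriv_reflect[OF g]])
qed

section \<open>Increments of a monotone random function\<close>

text \<open>This splits an integral over the countably many level sets of \<open>T\<close>; below, \<open>T\<close> records the grid
cell that contains a pair of random points.\<close>

lemma nn_integral_partition:
  fixes T :: "'a \<Rightarrow> 'b :: countable"
  assumes T: "T \<in> measurable M (count_space UNIV)" and [measurable]: "g \<in> borel_measurable M"
  shows "(\<integral>\<^sup>+\<omega>. g \<omega> \<partial>M) = (\<integral>\<^sup>+p. \<integral>\<^sup>+\<omega>. g \<omega> * indicator {\<omega>. T \<omega> = p} \<omega> \<partial>M \<partial>count_space UNIV)"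
proof -
  have [measurable]: "{\<omega> \<in> space M. T \<omega> = p} \<in> sets M" for p
    using measurable_sets[OF T, of "{p}"] by (simp add: vimage_def Int_def conj_commute)
  have "(\<integral>\<^sup>+p. g \<omega> * indicator {\<omega>. T \<omega> = p} \<omega> \<partial>count_space UNIV) = g \<omega>" for \<omega>
  proof -
    have "(\<integral>\<^sup>+p. g \<omega> * indicator {\<omega>. T \<omega> = p} \<omega> \<partial>count_space UNIV)
      = (\<integral>\<^sup>+p. g \<omega> * indicator {T \<omega>} p \<partial>count_space UNIV)"
      by (intro nn_integral_cong) (auto split: split_indicator)
    then show ?thesis by (simp add: nn_integral_cmult)
  qed
  then have "(\<integral>\<^sup>+\<omega>. g \<omega> \<partial>M) = (\<integral>\<^sup>+\<omega>. \<integral>\<^sup>+p. g \<omega> * indicator {\<omega>. T \<omega> = p} \<omega> \<partial>count_space UNIV \<partial>M)"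
    by simp
  also have "\<dots> = (\<integral>\<^sup>+p. \<integral>\<^sup>+\<omega>. g \<omega> * indicator {\<omega>. T \<omega> = p} \<omega> \<partial>M \<partial>count_space UNIV)"
    by (intro nn_integral_count_space_nn_integral) auto
  finally show ?thesis .
qed

lemma integrable_mult_of_square_integrable:
  fixes u v :: "'a \<Rightarrow> real"
  assumes [measurable]: "u \<in> borel_measurable M" "v \<in> borel_measurable M"
    and "integrable M (\<lambda>x. (u x)\<^sup>2)" "integrable M (\<lambda>x. (v x)\<^sup>2)"
  shows "integrable M (\<lambda>x. u x * v x)"
proof (rule Bochner_Integration.integrable_bound)
  show "integrable M (\<lambda>x. (u x)\<^sup>2 + (v x)\<^sup>2)" using assms by simp
  have "\<bar>u x * v x\<bar> \<le> (u x)\<^sup>2 + (v x)\<^sup>2" for x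
    using sum_squares_bound[of "\<bar>u x\<bar>" "\<bar>v x\<bar>"] abs_ge_zero[of "u x * v x"]
    unfolding abs_mult power2_abs by linarith
  then show "AE x in M. norm (u x * v x) \<le> norm ((u x)\<^sup>2 + (v x)\<^sup>2)" by simp
qed simp

lemma square_integrable_add:
  fixes u v :: "'a \<Rightarrow> real"
  assumes [measurable]: "u \<in> borel_measurable M" "v \<in> borel_measurable M"
    and "integrable M (\<lambda>x. (u x)\<^sup>2)" "integrable M (\<lambda>x. (v x)\<^sup>2)"
  shows "integrable M (\<lambda>x. (u x + v x)\<^sup>2)"
  unfolding power2_sum using assms integrable_mult_of_square_integrable[OF assms]
  by (simp add: mult.assoc)

text \<open>The hypothesis \<open>lip\<close> below controls increments of \<open>\<zeta>\<close> only between two deterministic points, with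
an exceptional null set that depends on these points. The purpose of this context is to carry
the bound over to points that are random but \<open>G\<close>-measurable: there are only countably many grid
points, and monotonicity lets the random points be rounded outwards to them.\<close>

context
  fixes M G :: "'w measure" and \<zeta> :: "real \<Rightarrow> 'w \<Rightarrow> real" and L :: real
  assumes prob: "prob_space M" and subalg: "subalgebra M G"
    and mono: "\<And>x y \<omega>. \<omega> \<in> space M \<Longrightarrow> x \<le> y \<Longrightarrow> \<zeta> x \<omega> \<le> \<zeta> y \<omega>"
    and meas [measurable]: "\<And>x. \<zeta> x \<in> borel_measurable M"
    and sq: "\<And>x. integrable M (\<lambda>\<omega>. (\<zeta> x \<omega>)\<^sup>2)"
    and lip: "\<And>x y. AE \<omega> in M. \<bar>real_cond_exp M G (\<lambda>\<omega>. \<zeta> x \<omega> - \<zeta> y \<omega>) \<omega>\<bar> \<le> L * \<bar>x - y\<bar>"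
begin

text \<open>Testing the conditional expectation of the increment against the nonnegative \<open>G\<close>-measurable
function \<open>w\<close> restricted to \<open>A\<close>. Stating the bound for nonnegative integrals allows the cells of a
partition to be summed without integrability considerations.\<close>

lemma increment_bound_deterministic:
  assumes w [measurable]: "w \<in> borel_measurable G" and w_nonneg: "\<And>\<omega>. 0 \<le> w \<omega>"
    and w_sq: "integrable M (\<lambda>\<omega>. (w \<omega>)\<^sup>2)" and "x \<le> y" and A [measurable]: "A \<in> sets G"
  shows "(\<integral>\<^sup>+\<omega>. ennreal ((\<zeta> y \<omega> - \<zeta> x \<omega>) * w \<omega>) * indicator A \<omega> \<partial>M)
    \<le> (\<integral>\<^sup>+\<omega>. ennreal (L * (y - x) * w \<omega>) * indicator A \<omega> \<partial>M)"
proof -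
  interpret prob_space M by (rule prob)
  interpret finite_measure_subalgebra M G by standard (rule subalg)
  define W where "W = (\<lambda>\<omega>. w \<omega> * indicator A \<omega>)"
  have WG [measurable]: "W \<in> borel_measurable G" unfolding W_def by measurable
  have [measurable]: "W \<in> borel_measurable M" by (rule measurable_from_subalg[OF subalg WG])
  have [measurable]: "w \<in> borel_measurable M" by (rule measurable_from_subalg[OF subalg w])
  have W_nonneg: "0 \<le> W \<omega>" for \<omega> unfolding W_def using w_nonneg by simp
  have W_sq: "integrable M (\<lambda>\<omega>. (W \<omega>)\<^sup>2)"
    by (rule Bochner_Integration.integrable_bound[OF w_sq], measurable)
      (auto simp: W_def split: split_indicator)
  have W_int: "integrable M W"
    using integrable_mult_of_square_integrable[OF _ _ W_sq, of "\<lambda>_. 1"] by simp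
  have d_sq: "integrable M (\<lambda>\<omega>. (\<zeta> y \<omega> + - \<zeta> x \<omega>)\<^sup>2)"
    using sq by (intro square_integrable_add) auto
  have int: "integrable M (\<lambda>\<omega>. W \<omega> * (\<zeta> y \<omega> - \<zeta> x \<omega>))"
    using W_sq d_sq by (intro integrable_mult_of_square_integrable) auto
  note cond = real_cond_exp_intg[OF int WG]
  have "(\<integral>\<omega>. W \<omega> * (\<zeta> y \<omega> - \<zeta> x \<omega>) \<partial>M)
      = (\<integral>\<omega>. W \<omega> * real_cond_exp M G (\<lambda>\<omega>. \<zeta> y \<omega> - \<zeta> x \<omega>) \<omega> \<partial>M)"
    by (subst cond(2)) auto
  also have "\<dots> \<le> (\<integral>\<omega>. W \<omega> * (L * (y - x)) \<partial>M)"
  proof (rule integral_mono_AE)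
    show "AE \<omega> in M. W \<omega> * real_cond_exp M G (\<lambda>\<omega>. \<zeta> y \<omega> - \<zeta> x \<omega>) \<omega> \<le> W \<omega> * (L * (y - x))"
      using lip[of y x] by eventually_elim (use \<open>x \<le> y\<close> W_nonneg in \<open>auto intro!: mult_left_mono\<close>)
  qed (use cond(1) W_int in auto)
  finally have le: "(\<integral>\<omega>. W \<omega> * (\<zeta> y \<omega> - \<zeta> x \<omega>) \<partial>M) \<le> (\<integral>\<omega>. W \<omega> * (L * (y - x)) \<partial>M)" .
  have "(\<integral>\<^sup>+\<omega>. ennreal ((\<zeta> y \<omega> - \<zeta> x \<omega>) * w \<omega>) * indicator A \<omega> \<partial>M)
      = (\<integral>\<^sup>+\<omega>. ennreal (W \<omega> * (\<zeta> y \<omega> - \<zeta> x \<omega>)) \<partial>M)"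
    by (intro nn_integral_cong) (auto simp: W_def mult.commute split: split_indicator)
  also have "\<dots> = ennreal (\<integral>\<omega>. W \<omega> * (\<zeta> y \<omega> - \<zeta> x \<omega>) \<partial>M)"
    using int W_nonneg mono[OF _ \<open>x \<le> y\<close>]
    by (intro nn_integral_eq_integral AE_I2 mult_nonneg_nonneg) auto
  also have "\<dots> \<le> ennreal (\<integral>\<omega>. W \<omega> * (L * (y - x)) \<partial>M)" using le by (rule ennreal_leI)
  also have "\<dots> \<le> (\<integral>\<^sup>+\<omega>. ennreal (W \<omega> * (L * (y - x))) \<partial>M)"
    using W_int
    by (cases "0 \<le> L * (y - x)")
      (auto simp: W_nonneg nn_integral_eq_integral ennreal_neg mult_nonneg_nonpos intro!: eq_refl
        nn_integral_eq_integral[symmetric])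
  also have "\<dots> = (\<integral>\<^sup>+\<omega>. ennreal (L * (y - x) * w \<omega>) * indicator A \<omega> \<partial>M)"
    by (intro nn_integral_cong) (auto simp: W_def mult.commute split: split_indicator)
  finally show ?thesis .
qed

text \<open>On the event that \<open>p\<close> and \<open>q\<close> lie in fixed cells of a grid of width \<open>h\<close>, monotonicity bounds the
increment of \<open>\<zeta>\<close> between them by the increment between two grid points, whose distance exceeds
\<open>q - p\<close> by at most \<open>2 * h\<close>. Summing over the cells leaves an error proportional to \<open>h\<close>, which
vanishes as the grid is refined.\<close>

lemma increment_bound_ordered:
  assumes p [measurable]: "p \<in> borel_measurable G" and q [measurable]: "q \<in> borel_measurable G"
    and pq: "\<And>\<omega>. p \<omega> \<le> q \<omega>"
    and sq_diff: "integrable M (\<lambda>\<omega>. (q \<omega> - p \<omega>)\<^sup>2)"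
    and [measurable]: "(\<lambda>\<omega>. \<zeta> (p \<omega>) \<omega>) \<in> borel_measurable M" "(\<lambda>\<omega>. \<zeta> (q \<omega>) \<omega>) \<in> borel_measurable M"
    and "0 < L"
  shows "(\<integral>\<^sup>+\<omega>. ennreal ((\<zeta> (q \<omega>) \<omega> - \<zeta> (p \<omega>) \<omega>) * (q \<omega> - p \<omega>)) \<partial>M)
    \<le> ennreal (L * (\<integral>\<omega>. (q \<omega> - p \<omega>)\<^sup>2 \<partial>M))"
proof -
  interpret prob_space M by (rule prob)
  define w where "w = (\<lambda>\<omega>. q \<omega> - p \<omega>)"
  have wG [measurable]: "w \<in> borel_measurable G" unfolding w_def by measurable
  have [measurable]: "w \<in> borel_measurable M" by (rule measurable_from_subalg[OF subalg wG])
  have [measurable]: "p \<in> borel_measurable M" "q \<in> borel_measurable M"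
    by (rule measurable_from_subalg[OF subalg p] measurable_from_subalg[OF subalg q])+
  have w_nonneg: "0 \<le> w \<omega>" for \<omega> using pq by (simp add: w_def)
  have w_sq: "integrable M (\<lambda>\<omega>. (w \<omega>)\<^sup>2)" using sq_diff by (simp add: w_def)
  have w_int: "integrable M w"
    using integrable_mult_of_square_integrable[OF _ _ w_sq, of "\<lambda>_. 1"] by simp
  have mesh: "(\<integral>\<^sup>+\<omega>. ennreal ((\<zeta> (q \<omega>) \<omega> - \<zeta> (p \<omega>) \<omega>) * w \<omega>) \<partial>M)
      \<le> ennreal (L * (\<integral>\<omega>. (w \<omega>)\<^sup>2 \<partial>M) + h * (2 * L * (\<integral>\<omega>. w \<omega> \<partial>M)))" (is "?D \<le> _") if "0 < h" for h
  proof -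
    define T where "T = (\<lambda>\<omega>. (\<lfloor>p \<omega> / h\<rfloor>, \<lfloor>q \<omega> / h\<rfloor>))"
    have TG: "T \<in> measurable G (count_space UNIV)"
      unfolding T_def by measurable
    have TM: "T \<in> measurable M (count_space UNIV)" by (rule measurable_from_subalg[OF subalg TG])
    have cell: "(\<integral>\<^sup>+\<omega>. ennreal ((\<zeta> (q \<omega>) \<omega> - \<zeta> (p \<omega>) \<omega>) * w \<omega>) * indicator {\<omega>. T \<omega> = (i, j)} \<omega> \<partial>M)
        \<le> (\<integral>\<^sup>+\<omega>. ennreal (L * (w \<omega> + 2 * h) * w \<omega>) * indicator {\<omega>. T \<omega> = (i, j)} \<omega> \<partial>M)" for i j
    proof (cases "i \<le> j")
      case False
      have "T \<omega> \<noteq> (i, j)" for \<omega>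
        using floor_mono[OF divide_right_mono[OF pq, of h]] False \<open>0 < h\<close>
        by (force simp: T_def)
      then show ?thesis by simp
    next
      case True
      \<comment> \<open>The outward roundings of \<open>p\<close> and \<open>q\<close> on this cell.\<close>
      define x where "x = real_of_int i * h"
      define y where "y = (real_of_int j + 1) * h"
      have "x \<le> y" unfolding x_def y_def using True \<open>0 < h\<close> by (intro mult_right_mono) auto
      have bounds: "x \<le> p \<omega>" "p \<omega> < x + h" "q \<omega> \<le> y" "y \<le> q \<omega> + h" if "T \<omega> = (i, j)" for \<omega>
        using that \<open>0 < h\<close>
          of_int_floor_le[of "p \<omega> / h"] floor_correct[of "p \<omega> / h"] floor_correct[of "q \<omega> / h"]
        unfolding T_def x_def y_def by (auto simp: field_simps)
      define A where "A = {\<omega> \<in> space M. T \<omega> = (i, j)}"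
      have A: "A \<in> sets G"
        using measurable_sets[OF TG, of "{(i, j)}"] subalg
        by (simp add: A_def vimage_def Int_def conj_commute subalgebra_def)
      have "(\<integral>\<^sup>+\<omega>. ennreal ((\<zeta> (q \<omega>) \<omega> - \<zeta> (p \<omega>) \<omega>) * w \<omega>) * indicator {\<omega>. T \<omega> = (i, j)} \<omega> \<partial>M)
          \<le> (\<integral>\<^sup>+\<omega>. ennreal ((\<zeta> y \<omega> - \<zeta> x \<omega>) * w \<omega>) * indicator A \<omega> \<partial>M)"
        using w_nonneg bounds mono
        by (intro nn_integral_mono)
          (auto simp: A_def split: split_indicator intro!: ennreal_leI mult_right_mono diff_mono)
      also have "\<dots> \<le> (\<integral>\<^sup>+\<omega>. ennreal (L * (y - x) * w \<omega>) * indicator A \<omega> \<partial>M)"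
        by (rule increment_bound_deterministic[OF wG w_nonneg w_sq \<open>x \<le> y\<close> A])
      also have "\<dots> \<le> (\<integral>\<^sup>+\<omega>. ennreal (L * (w \<omega> + 2 * h) * w \<omega>) * indicator {\<omega>. T \<omega> = (i, j)} \<omega> \<partial>M)"
      proof (intro nn_integral_mono)
        fix \<omega>
        show "ennreal (L * (y - x) * w \<omega>) * indicator A \<omega>
            \<le> ennreal (L * (w \<omega> + 2 * h) * w \<omega>) * indicator {\<omega>. T \<omega> = (i, j)} \<omega>"
        proof (cases "\<omega> \<in> A")
          case True
          then have "T \<omega> = (i, j)" by (simp add: A_def)
          then have "y - x \<le> w \<omega> + 2 * h" using bounds[of \<omega>] by (simp add: w_def)
          then show ?thesis using \<open>T \<omega> = (i, j)\<close> True w_nonneg \<open>0 < L\<close>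
            by (auto intro!: ennreal_leI mult_right_mono mult_left_mono)
        qed simp
      qed
      finally show ?thesis .
    qed
    have "?D \<le> (\<integral>\<^sup>+\<omega>. ennreal (L * (w \<omega> + 2 * h) * w \<omega>) \<partial>M)"
      unfolding nn_integral_partition[OF TM, of "\<lambda>\<omega>. ennreal (L * (w \<omega> + 2 * h) * w \<omega>)", simplified]
        nn_integral_partition[OF TM, of "\<lambda>\<omega>. ennreal ((\<zeta> (q \<omega>) \<omega> - \<zeta> (p \<omega>) \<omega>) * w \<omega>)", simplified]
      by (rule nn_integral_mono) (auto simp: split_paired_all cell)
    also have "\<dots> = (\<integral>\<^sup>+\<omega>. ennreal (L * (w \<omega>)\<^sup>2 + h * (2 * L * w \<omega>)) \<partial>M)"
      by (intro nn_integral_cong arg_cong[of _ _ ennreal]) (simp add: algebra_simps power2_eq_square)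
    also have "\<dots> = ennreal (\<integral>\<omega>. L * (w \<omega>)\<^sup>2 + h * (2 * L * w \<omega>) \<partial>M)"
      using w_sq w_int w_nonneg \<open>0 < L\<close> \<open>0 < h\<close> by (intro nn_integral_eq_integral) auto
    also have "(\<integral>\<omega>. L * (w \<omega>)\<^sup>2 + h * (2 * L * w \<omega>) \<partial>M)
        = L * (\<integral>\<omega>. (w \<omega>)\<^sup>2 \<partial>M) + h * (2 * L * (\<integral>\<omega>. w \<omega> \<partial>M))"
      using w_sq w_int by simp
    finally show ?thesis .
  qed
  have "((\<lambda>h. ennreal (L * (\<integral>\<omega>. (w \<omega>)\<^sup>2 \<partial>M) + h * (2 * L * (\<integral>\<omega>. w \<omega> \<partial>M))))
      \<longlongrightarrow> ennreal (L * (\<integral>\<omega>. (w \<omega>)\<^sup>2 \<partial>M) + 0 * (2 * L * (\<integral>\<omega>. w \<omega> \<partial>M)))) (at_right 0)"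
    by (intro tendsto_ennrealI tendsto_intros)
  then have "(\<integral>\<^sup>+\<omega>. ennreal ((\<zeta> (q \<omega>) \<omega> - \<zeta> (p \<omega>) \<omega>) * w \<omega>) \<partial>M)
      \<le> ennreal (L * (\<integral>\<omega>. (w \<omega>)\<^sup>2 \<partial>M) + 0 * (2 * L * (\<integral>\<omega>. w \<omega> \<partial>M)))"
    by (rule tendsto_lowerbound)
      (use mesh in \<open>auto intro: eventually_at_right_less[THEN eventually_mono]\<close>)
  then show ?thesis by (simp add: w_def)
qed

text \<open>The product \<open>(\<zeta> v - \<zeta> u) * (v - u)\<close> is symmetric in the two points, so it suffices to treat their
pointwise minimum and maximum.\<close>

lemma increment_bound:
  assumes u [measurable]: "u \<in> borel_measurable G" and v [measurable]: "v \<in> borel_measurable G"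
    and sq_diff: "integrable M (\<lambda>\<omega>. (v \<omega> - u \<omega>)\<^sup>2)"
    and [measurable]: "(\<lambda>\<omega>. \<zeta> (u \<omega>) \<omega>) \<in> borel_measurable M" "(\<lambda>\<omega>. \<zeta> (v \<omega>) \<omega>) \<in> borel_measurable M"
    and int: "integrable M (\<lambda>\<omega>. (\<zeta> (v \<omega>) \<omega> - \<zeta> (u \<omega>) \<omega>) * (v \<omega> - u \<omega>))"
    and "0 < L"
  shows "(\<integral>\<omega>. (\<zeta> (v \<omega>) \<omega> - \<zeta> (u \<omega>) \<omega>) * (v \<omega> - u \<omega>) \<partial>M) \<le> L * (\<integral>\<omega>. (v \<omega> - u \<omega>)\<^sup>2 \<partial>M)"
proof -
  define p where "p = (\<lambda>\<omega>. min (u \<omega>) (v \<omega>))"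
  define q where "q = (\<lambda>\<omega>. max (u \<omega>) (v \<omega>))"
  have [measurable]: "u \<in> borel_measurable M" "v \<in> borel_measurable M"
    by (rule measurable_from_subalg[OF subalg u] measurable_from_subalg[OF subalg v])+
  have [measurable]: "p \<in> borel_measurable G" "q \<in> borel_measurable G"
    unfolding p_def q_def by measurable
  have sq_eq: "(q \<omega> - p \<omega>)\<^sup>2 = (v \<omega> - u \<omega>)\<^sup>2" for \<omega>
    by (simp add: p_def q_def min_def max_def power2_commute)
  have prod_eq: "(\<zeta> (q \<omega>) \<omega> - \<zeta> (p \<omega>) \<omega>) * (q \<omega> - p \<omega>) = (\<zeta> (v \<omega>) \<omega> - \<zeta> (u \<omega>) \<omega>) * (v \<omega> - u \<omega>)" for \<omega>
    by (simp add: p_def q_def min_def max_def algebra_simps)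
  have "(\<lambda>\<omega>. if u \<omega> \<le> v \<omega> then \<zeta> (u \<omega>) \<omega> else \<zeta> (v \<omega>) \<omega>) \<in> borel_measurable M"
    "(\<lambda>\<omega>. if u \<omega> \<le> v \<omega> then \<zeta> (v \<omega>) \<omega> else \<zeta> (u \<omega>) \<omega>) \<in> borel_measurable M"
    by measurable
  then have "(\<lambda>\<omega>. \<zeta> (p \<omega>) \<omega>) \<in> borel_measurable M" "(\<lambda>\<omega>. \<zeta> (q \<omega>) \<omega>) \<in> borel_measurable M"
    by (auto simp: p_def q_def min_def max_def if_distrib[of \<zeta>] if_distribR cong: if_cong)
  then have "(\<integral>\<^sup>+\<omega>. ennreal ((\<zeta> (q \<omega>) \<omega> - \<zeta> (p \<omega>) \<omega>) * (q \<omega> - p \<omega>)) \<partial>M)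
    \<le> ennreal (L * (\<integral>\<omega>. (q \<omega> - p \<omega>)\<^sup>2 \<partial>M))"
    using sq_diff \<open>0 < L\<close>
    by (intro increment_bound_ordered) (simp_all add: sq_eq, simp add: p_def q_def)
  then have le: "(\<integral>\<^sup>+\<omega>. ennreal ((\<zeta> (v \<omega>) \<omega> - \<zeta> (u \<omega>) \<omega>) * (v \<omega> - u \<omega>)) \<partial>M)
    \<le> ennreal (L * (\<integral>\<omega>. (v \<omega> - u \<omega>)\<^sup>2 \<partial>M))"
    unfolding prod_eq sq_eq .
  have "0 \<le> (\<zeta> (v \<omega>) \<omega> - \<zeta> (u \<omega>) \<omega>) * (v \<omega> - u \<omega>)" if "\<omega> \<in> space M" for \<omega>
    using mono[OF that, of "u \<omega>" "v \<omega>"] mono[OF that, of "v \<omega>" "u \<omega>"]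
    by (cases "u \<omega>" "v \<omega>" rule: le_cases) (auto intro: mult_nonneg_nonneg mult_nonpos_nonpos)
  then show ?thesis
    using le nn_integral_eq_integral[OF int] \<open>0 < L\<close>
    by (subst (asm) nn_integral_eq_integral[OF int]) (auto simp: ennreal_le_iff)
qed

end

section \<open>The space of square-integrable functions and the linear span\<close>

lemma L2_space_add:
  assumes "g \<in> L2_space N" "h \<in> L2_space N"
  shows "(\<lambda>x. g x + h x) \<in> L2_space N"
  using assms square_integrable_add[of g N h] by (auto simp: L2_space_def)

lemma L2_space_scale:
  assumes "g \<in> L2_space N"
  shows "(\<lambda>x. c * g x) \<in> L2_space N"
  using assms by (auto simp: L2_space_def power_mult_distrib)

lemma L2_space_diff:
  assumes "g \<in> L2_space N" "h \<in> L2_space N"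
  shows "(\<lambda>x. g x - h x) \<in> L2_space N"
  using L2_space_add[OF assms(1) L2_space_scale[OF assms(2), of "-1"]] by simp

lemma L2_space_sum:
  assumes "\<And>i. i < n \<Longrightarrow> g i \<in> L2_space N"
  shows "(\<lambda>x. \<Sum>i<(n::nat). c i * g i x) \<in> L2_space N"
  using assms
proof (induction n)
  case 0
  show ?case by (simp add: L2_space_def)
next
  case (Suc n)
  then show ?case by (auto intro!: L2_space_add L2_space_scale)
qed

lemma L2_norm_nonneg: "0 \<le> L2_norm N g"
  by (simp add: L2_norm_def)

lemma L2_norm_scale_sq: "(L2_norm N (\<lambda>x. c * g x))\<^sup>2 = c\<^sup>2 * (L2_norm N g)\<^sup>2"
  by (simp add: L2_norm_def power_mult_distrib)

lemma subset_lin: "g \<in> P \<Longrightarrow> g \<in> lin P"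
  unfolding lin_def by (auto intro!: exI[of _ "Suc 0"] exI[of _ "\<lambda>_. 1"] exI[of _ "\<lambda>_. g"])

lemma lin_add_scaled:
  assumes "G \<in> lin P" "g \<in> P"
  shows "(\<lambda>x. G x + c * g x) \<in> lin P"
proof -
  from assms obtain n :: nat and d h
    where h: "\<forall>i<n. h i \<in> P" and G: "G = (\<lambda>x. \<Sum>i<n. d i * h i x)"
    unfolding lin_def by blast
  have "(\<lambda>x. G x + c * g x) = (\<lambda>x. \<Sum>i<Suc n. (d(n := c)) i * (h(n := g)) i x)"
    unfolding G by (auto intro!: ext sum.cong)
  moreover have "\<forall>i<Suc n. (h(n := g)) i \<in> P" using h assms(2) by simp
  ultimately show ?thesis unfolding lin_def by blast
qed

section \<open>Risk and score of a convex loss\<close>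

text \<open>The hypotheses that concern the loss and the law of the data, with an arbitrary measurable space
\<open>S\<close> of features. The condition \<open>deriv_L2\<close> is local boundedness of the one-sided derivatives read at
a single function; it makes \<open>\<xi>\<close> square-integrable along that function.\<close>

locale convex_boosting = prob_space M for M :: "'w measure" +
  fixes S :: "'x measure" and X :: "'w \<Rightarrow> 'x" and YY :: "real set" and Y :: "'w \<Rightarrow> real"
    and \<psi> \<xi> :: "real \<Rightarrow> real \<Rightarrow> real" and L :: real
  assumes X [measurable]: "X \<in> measurable M S"
    and Y [measurable]: "Y \<in> measurable M (restrict_space borel YY)"
    and \<psi>_nonneg: "y \<in> YY \<Longrightarrow> 0 \<le> \<psi> x y"
    and \<psi>_meas: "(\<lambda>(x, y). \<psi> x y) \<in> borel_measurable (borel \<Otimes>\<^sub>M restrict_space borel YY)"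
    and \<psi>_convex: "y \<in> YY \<Longrightarrow> convex_on UNIV (\<lambda>x. \<psi> x y)"
    and \<xi>_meas: "(\<lambda>(x, y). \<xi> x y) \<in> borel_measurable (borel \<Otimes>\<^sub>M restrict_space borel YY)"
    and \<xi>_subgrad:
      "y \<in> YY \<Longrightarrow> \<xi> x y \<in> {left_deriv (\<lambda>u. \<psi> u y) x .. right_deriv (\<lambda>u. \<psi> u y) x}"
    and risk0: "(\<integral>\<^sup>+\<omega>. ennreal (\<psi> 0 (Y \<omega>)) \<partial>M) < \<infinity>"
    and deriv_L2: "G \<in> L2_space (distr M S X) \<Longrightarrow>
      (\<integral>\<^sup>+\<omega>. ennreal (\<bar>left_deriv (\<lambda>u. \<psi> u (Y \<omega>)) (G (X \<omega>))\<bar>\<^sup>2) \<partial>M) +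
      (\<integral>\<^sup>+\<omega>. ennreal (\<bar>right_deriv (\<lambda>u. \<psi> u (Y \<omega>)) (G (X \<omega>))\<bar>\<^sup>2) \<partial>M) < \<infinity>"
    and cond_lipschitz: "AE \<omega> in M. \<bar>real_cond_exp M (vimage_algebra (space M) X S)
            (\<lambda>\<omega>. \<xi> x1 (Y \<omega>) - \<xi> x2 (Y \<omega>)) \<omega>\<bar> \<le> L * \<bar>x1 - x2\<bar>"
    and L_pos: "0 < L"
begin

abbreviation law :: "'x measure" where "law \<equiv> distr M S X"

text \<open>The pairing of \<open>g\<close> with the subgradient of the risk at \<open>F\<close> that \<open>\<xi>\<close> induces; for a differentiable
loss it is the derivative of the risk at \<open>F\<close> in direction \<open>g\<close>.\<close>

definition score :: "('x \<Rightarrow> real) \<Rightarrow> ('x \<Rightarrow> real) \<Rightarrow> real" where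
  "score F g = (\<integral>\<omega>. \<xi> (F (X \<omega>)) (Y \<omega>) * g (X \<omega>) \<partial>M)"

definition mean_loss :: "('x \<Rightarrow> real) \<Rightarrow> real" where
  "mean_loss F = (\<integral>\<omega>. \<psi> (F (X \<omega>)) (Y \<omega>) \<partial>M)"

lemma Y_in: "\<omega> \<in> space M \<Longrightarrow> Y \<omega> \<in> YY"
  using measurable_space[OF Y, of \<omega>] by (simp add: space_restrict_space)

lemma L2_measurable:
  assumes "g \<in> L2_space law"
  shows "g \<in> borel_measurable S" "(\<lambda>\<omega>. g (X \<omega>)) \<in> borel_measurable M"
    "integrable M (\<lambda>\<omega>. (g (X \<omega>))\<^sup>2)"
proof -
  show [measurable]: "g \<in> borel_measurable S" using assms by (simp add: L2_space_def)
  then show "(\<lambda>\<omega>. g (X \<omega>)) \<in> borel_measurable M" by measurable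
  show "integrable M (\<lambda>\<omega>. (g (X \<omega>))\<^sup>2)"
    using assms by (simp add: L2_space_def integrable_distr_eq)
qed

lemma L2_norm_sq:
  assumes "g \<in> L2_space law"
  shows "(L2_norm law g)\<^sup>2 = (\<integral>\<omega>. (g (X \<omega>))\<^sup>2 \<partial>M)"
  using L2_measurable(1)[OF assms] by (simp add: L2_norm_def integral_distr)

lemma \<xi>_measurable: "u \<in> borel_measurable M \<Longrightarrow> (\<lambda>\<omega>. \<xi> (u \<omega>) (Y \<omega>)) \<in> borel_measurable M"
  using measurable_compose[OF measurable_Pair \<xi>_meas, of u M Y] Y by simp

lemma \<psi>_measurable: "u \<in> borel_measurable M \<Longrightarrow> (\<lambda>\<omega>. \<psi> (u \<omega>) (Y \<omega>)) \<in> borel_measurable M"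
  using measurable_compose[OF measurable_Pair \<psi>_meas, of u M Y] Y by simp

lemma \<psi>_above_tangent: "y \<in> YY \<Longrightarrow> \<psi> x y + \<xi> x y * (z - x) \<le> \<psi> z y"
  by (rule subgradient_inequality[OF \<psi>_convex \<xi>_subgrad])

lemma \<xi>_mono:
  assumes "y \<in> YY" "x \<le> z"
  shows "\<xi> x y \<le> \<xi> z y"
proof (cases "x = z")
  case False
  have "0 \<le> (\<xi> z y - \<xi> x y) * (z - x)"
    using \<psi>_above_tangent[OF assms(1), of x z] \<psi>_above_tangent[OF assms(1), of z x]
    by (simp add: algebra_simps)
  then show ?thesis using False assms(2) by (simp add: zero_le_mult_iff)
qed simp

lemma \<xi>_square_integrable:
  assumes G: "G \<in> L2_space law"
  shows "integrable M (\<lambda>\<omega>. (\<xi> (G (X \<omega>)) (Y \<omega>))\<^sup>2)"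
proof -
  define l where "l = (\<lambda>\<omega>. left_deriv (\<lambda>u. \<psi> u (Y \<omega>)) (G (X \<omega>)))"
  define r where "r = (\<lambda>\<omega>. right_deriv (\<lambda>u. \<psi> u (Y \<omega>)) (G (X \<omega>)))"
  note [measurable] = L2_measurable(2)[OF G]
  have [measurable]: "l \<in> borel_measurable M" "r \<in> borel_measurable M"
    unfolding l_def r_def
    by (intro measurable_left_deriv measurable_right_deriv \<psi>_convex Y_in \<psi>_measurable; simp)+
  have "(\<integral>\<^sup>+\<omega>. ennreal ((\<xi> (G (X \<omega>)) (Y \<omega>))\<^sup>2) \<partial>M)
      \<le> (\<integral>\<^sup>+\<omega>. ennreal (\<bar>l \<omega>\<bar>\<^sup>2) + ennreal (\<bar>r \<omega>\<bar>\<^sup>2) \<partial>M)"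
  proof (rule nn_integral_mono)
    fix \<omega> assume "\<omega> \<in> space M"
    then have "l \<omega> \<le> \<xi> (G (X \<omega>)) (Y \<omega>)" "\<xi> (G (X \<omega>)) (Y \<omega>) \<le> r \<omega>"
      using \<xi>_subgrad[OF Y_in] by (auto simp: l_def r_def)
    then have "(\<xi> (G (X \<omega>)) (Y \<omega>))\<^sup>2 \<le> (max \<bar>l \<omega>\<bar> \<bar>r \<omega>\<bar>)\<^sup>2"
      by (intro power2_le_iff_abs_le[THEN iffD2]) auto
    also have "\<dots> \<le> \<bar>l \<omega>\<bar>\<^sup>2 + \<bar>r \<omega>\<bar>\<^sup>2" by (simp add: max_def)
    finally show "ennreal ((\<xi> (G (X \<omega>)) (Y \<omega>))\<^sup>2) \<le> ennreal (\<bar>l \<omega>\<bar>\<^sup>2) + ennreal (\<bar>r \<omega>\<bar>\<^sup>2)"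
      using ennreal_leI by (fastforce simp flip: ennreal_plus)
  qed
  also have "\<dots> = (\<integral>\<^sup>+\<omega>. ennreal (\<bar>l \<omega>\<bar>\<^sup>2) \<partial>M) + (\<integral>\<^sup>+\<omega>. ennreal (\<bar>r \<omega>\<bar>\<^sup>2) \<partial>M)"
    by (rule nn_integral_add) measurable
  also have "\<dots> < \<infinity>"
    using deriv_L2[OF G] by (simp add: l_def r_def)
  finally show ?thesis
    by (intro integrableI_bounded borel_measurable_power \<xi>_measurable) auto
qed

lemma score_integrable:
  assumes "F \<in> L2_space law" "g \<in> L2_space law"
  shows "integrable M (\<lambda>\<omega>. \<xi> (F (X \<omega>)) (Y \<omega>) * g (X \<omega>))"
  using assms
  by (intro integrable_mult_of_square_integrable \<xi>_measurable \<xi>_square_integrable L2_measurable)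

lemma score_add:
  assumes "F \<in> L2_space law" "g \<in> L2_space law" "h \<in> L2_space law"
  shows "score F (\<lambda>x. g x + h x) = score F g + score F h"
  using score_integrable[OF assms(1,2)] score_integrable[OF assms(1,3)]
  by (simp add: score_def distrib_left)

lemma score_diff:
  assumes "F \<in> L2_space law" "g \<in> L2_space law" "h \<in> L2_space law"
  shows "score F (\<lambda>x. g x - h x) = score F g - score F h"
  using score_integrable[OF assms(1,2)] score_integrable[OF assms(1,3)]
  by (simp add: score_def right_diff_distrib)

lemma score_scale: "score F (\<lambda>x. c * g x) = c * score F g"
  by (simp add: score_def mult.left_commute)

lemma score_sum:
  assumes "F \<in> L2_space law" "\<And>i. i < n \<Longrightarrow> g i \<in> L2_space law"
  shows "score F (\<lambda>x. \<Sum>i<(n::nat). c i * g i x) = (\<Sum>i<n. c i * score F (g i))"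
  using assms(2)
proof (induction n)
  case 0
  then show ?case by (simp add: score_def)
next
  case (Suc n)
  then show ?case
    using assms(1) by (simp add: score_add L2_space_sum L2_space_scale score_scale)
qed

text \<open>The tangent inequality at \<open>F\<close>, evaluated at \<open>0\<close>, bounds the nonnegative loss of \<open>F\<close> above by
\<open>\<psi> 0 Y + \<xi> (F X) Y * F X\<close>, and the last product is integrable as a product of two
square-integrable functions.\<close>

lemma loss_integrable:
  assumes F: "F \<in> L2_space law"
  shows "integrable M (\<lambda>\<omega>. \<psi> (F (X \<omega>)) (Y \<omega>))"
proof (rule Bochner_Integration.integrable_bound)
  have "integrable M (\<lambda>\<omega>. \<psi> 0 (Y \<omega>))"
    using risk0 \<psi>_nonneg[OF Y_in]
    by (intro integrableI_nonneg \<psi>_measurable) (auto intro!: AE_I2)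
  then show "integrable M (\<lambda>\<omega>. \<psi> 0 (Y \<omega>) + \<xi> (F (X \<omega>)) (Y \<omega>) * F (X \<omega>))"
    using score_integrable[OF F F] by simp
  show "(\<lambda>\<omega>. \<psi> (F (X \<omega>)) (Y \<omega>)) \<in> borel_measurable M"
    by (rule \<psi>_measurable[OF L2_measurable(2)[OF F]])
  show "AE \<omega> in M. norm (\<psi> (F (X \<omega>)) (Y \<omega>)) \<le> norm (\<psi> 0 (Y \<omega>) + \<xi> (F (X \<omega>)) (Y \<omega>) * F (X \<omega>))"
  proof (rule AE_I2)
    fix \<omega> assume "\<omega> \<in> space M"
    then show "norm (\<psi> (F (X \<omega>)) (Y \<omega>)) \<le> norm (\<psi> 0 (Y \<omega>) + \<xi> (F (X \<omega>)) (Y \<omega>) * F (X \<omega>))"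
      using \<psi>_above_tangent[OF Y_in, of \<omega> "F (X \<omega>)" 0] \<psi>_nonneg[OF Y_in, of \<omega> "F (X \<omega>)"] by simp
  qed
qed

lemma mean_loss_nonneg: "0 \<le> mean_loss F"
  unfolding mean_loss_def using \<psi>_nonneg[OF Y_in] by (intro integral_nonneg_AE AE_I2) auto

lemma risk_eq_mean_loss: "F \<in> L2_space law \<Longrightarrow> risk M X Y \<psi> F = ennreal (mean_loss F)"
  unfolding risk_def mean_loss_def using loss_integrable \<psi>_nonneg[OF Y_in]
  by (intro nn_integral_eq_integral AE_I2) auto

lemma mean_loss_above_tangent:
  assumes F: "F \<in> L2_space law" and H: "H \<in> L2_space law"
  shows "mean_loss F + score F (\<lambda>x. H x - F x) \<le> mean_loss H"
proof -
  note int = loss_integrable[OF F] score_integrable[OF F L2_space_diff[OF H F]]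
  have "mean_loss F + score F (\<lambda>x. H x - F x)
      = (\<integral>\<omega>. \<psi> (F (X \<omega>)) (Y \<omega>) + \<xi> (F (X \<omega>)) (Y \<omega>) * (H (X \<omega>) - F (X \<omega>)) \<partial>M)"
    using int by (simp add: mean_loss_def score_def)
  also have "\<dots> \<le> mean_loss H"
    unfolding mean_loss_def using int loss_integrable[OF H] \<psi>_above_tangent[OF Y_in]
    by (intro integral_mono) auto
  finally show ?thesis .
qed

text \<open>The conditional Lipschitz property in integrated form: the two random points \<open>F X\<close> and
\<open>F X + g X\<close> are functions of \<open>X\<close>, so the bound for monotone random functions applies to
\<open>\<lambda>x. \<xi> x Y\<close>.\<close>

lemma score_increment_bound:
  assumes F: "F \<in> L2_space law" and g: "g \<in> L2_space law"
  shows "score (\<lambda>x. F x + g x) g - score F g \<le> L * (L2_norm law g)\<^sup>2"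
proof -
  define \<zeta> where "\<zeta> = (\<lambda>x \<omega>. \<xi> x (Y \<omega>))"
  define A where "A = vimage_algebra (space M) X S"
  note Fg = L2_space_add[OF F g]
  have XA: "X \<in> measurable A S"
    unfolding A_def using measurable_space[OF X] by (intro measurable_vimage_algebra1) auto
  have subalg: "subalgebra M A"
    unfolding subalgebra_def A_def using X by (auto simp: sets_vimage_algebra2 measurable_space[OF X]
      intro: measurable_sets)
  have const: "(\<lambda>_. x) \<in> L2_space law" for x by (simp add: L2_space_def prob_space.finite_measure
      prob_space_distr[OF X] finite_measure.integrable_const)
  have int: "integrable M (\<lambda>\<omega>. (\<zeta> (F (X \<omega>) + g (X \<omega>)) \<omega> - \<zeta> (F (X \<omega>)) \<omega>) * g (X \<omega>))"
    using score_integrable[OF Fg g] score_integrable[OF F g] by (simp add: \<zeta>_def left_diff_distrib)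
  have "(\<integral>\<omega>. (\<zeta> (F (X \<omega>) + g (X \<omega>)) \<omega> - \<zeta> (F (X \<omega>)) \<omega>) * (F (X \<omega>) + g (X \<omega>) - F (X \<omega>)) \<partial>M)
      \<le> L * (\<integral>\<omega>. (F (X \<omega>) + g (X \<omega>) - F (X \<omega>))\<^sup>2 \<partial>M)"
  proof (rule increment_bound[of M A \<zeta> L])
    show "AE \<omega> in M. \<bar>real_cond_exp M A (\<lambda>\<omega>. \<zeta> x \<omega> - \<zeta> y \<omega>) \<omega>\<bar> \<le> L * \<bar>x - y\<bar>" for x y
      using cond_lipschitz unfolding A_def \<zeta>_def .
    show "integrable M (\<lambda>\<omega>. (\<zeta> x \<omega>)\<^sup>2)" for x
      using \<xi>_square_integrable[OF const] by (simp add: \<zeta>_def)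
  qed (use L2_measurable[OF F] L2_measurable[OF g] L2_measurable[OF Fg] L_pos int subalg XA
      in \<open>auto simp: \<zeta>_def intro: \<xi>_mono Y_in \<xi>_measurable prob_space_axioms measurable_compose[OF XA]
        intro!: borel_measurable_add\<close>)
  then show ?thesis
    using score_integrable[OF Fg g] score_integrable[OF F g]
    by (simp add: L2_norm_sq[OF g] score_def \<zeta>_def left_diff_distrib)
qed

text \<open>The tangent at the new point, not at the old one, bounds the new risk from above; replacing its
score by the score at the old point costs the Lipschitz term.\<close>

lemma mean_loss_descent:
  assumes F: "F \<in> L2_space law" and g: "g \<in> L2_space law"
  shows "mean_loss (\<lambda>x. F x + \<nu> * g x) \<le> mean_loss F + \<nu> * score F g + \<nu>\<^sup>2 * L * (L2_norm law g)\<^sup>2"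
proof -
  define F' where "F' = (\<lambda>x. F x + \<nu> * g x)"
  note \<nu>g = L2_space_scale[OF g, of \<nu>]
  have F': "F' \<in> L2_space law" unfolding F'_def by (rule L2_space_add[OF F \<nu>g])
  have "mean_loss F' + score F' (\<lambda>x. F x - F' x) \<le> mean_loss F"
    by (rule mean_loss_above_tangent[OF F' F])
  also have "(\<lambda>x. F x - F' x) = (\<lambda>x. (-1) * (\<nu> * g x))" by (simp add: F'_def)
  finally have "mean_loss F' \<le> mean_loss F + score F' (\<lambda>x. \<nu> * g x)"
    unfolding score_scale[of _ "-1"] by simp
  also have "\<dots> \<le> mean_loss F + score F (\<lambda>x. \<nu> * g x) + L * (L2_norm law (\<lambda>x. \<nu> * g x))\<^sup>2"
    using score_increment_bound[OF F \<nu>g] by (simp add: F'_def)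
  finally show ?thesis by (simp add: score_scale L2_norm_scale_sq F'_def mult_ac)
qed

section \<open>Convergence of the boosting iterates\<close>

text \<open>For \<open>g\<close> in the cone, the objective at \<open>s * g\<close> is a quadratic polynomial in \<open>s\<close> that stays above its
value at the minimizer \<open>f\<close>, so its discriminant is controlled. The choice \<open>g = f\<close> gives a
perfect square that is at most \<open>0\<close>, hence the first claim; a general \<open>g\<close> then gives the second.\<close>

lemma weak_learner_optimality:
  assumes cone: "\<And>a g. g \<in> P \<Longrightarrow> (\<lambda>x. a * g x) \<in> P"
    and min: "is_arg_min (boosting_objective M law X Y \<xi> F) (\<lambda>g. g \<in> P) f"
  shows "score F f = - (L2_norm law f)\<^sup>2"
    and "g \<in> P \<Longrightarrow> \<bar>score F g\<bar> \<le> L2_norm law g * L2_norm law f"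
proof -
  have obj: "boosting_objective M law X Y \<xi> F h = 2 * score F h + (L2_norm law h)\<^sup>2" for h
    by (simp add: boosting_objective_def score_def)
  have "f \<in> P" using min by (simp add: is_arg_min_def)
  have disc: "(score F g)\<^sup>2 \<le> (L2_norm law g)\<^sup>2 * - (2 * score F f + (L2_norm law f)\<^sup>2)"
    if "g \<in> P" for g
  proof (rule quadratic_nonneg_imp_discriminant_le)
    fix s
    have "\<not> boosting_objective M law X Y \<xi> F (\<lambda>x. s * g x) < boosting_objective M law X Y \<xi> F f"
      using min cone[OF that, of s] by (simp add: is_arg_min_def)
    then show "0 \<le> s\<^sup>2 * (L2_norm law g)\<^sup>2 + 2 * s * score F g + - (2 * score F f + (L2_norm law f)\<^sup>2)"
      by (simp add: obj score_scale L2_norm_scale_sq)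
  qed simp
  have "(score F f + (L2_norm law f)\<^sup>2)\<^sup>2 \<le> 0"
    using disc[OF \<open>f \<in> P\<close>] by (simp add: power2_eq_square algebra_simps)
  then show eq: "score F f = - (L2_norm law f)\<^sup>2" by simp
  assume "g \<in> P"
  then have "(score F g)\<^sup>2 \<le> (L2_norm law g * L2_norm law f)\<^sup>2"
    using disc[of g] by (simp add: eq power_mult_distrib)
  then show "\<bar>score F g\<bar> \<le> L2_norm law g * L2_norm law f"
    by (simp add: abs_le_square_iff[symmetric] abs_mult L2_norm_nonneg)
qed

text \<open>The risk decreases, so it tends to its infimum along the run, and only the comparison of this
infimum with the risk of a fixed \<open>G\<close> in the span is at stake. The tangent at \<open>F t\<close> reduces it to
finding, for every tolerance, a single index \<open>t\<close> at which \<open>score (F t) (G - F t)\<close> is small.\<close>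

theorem boosting_risk_tendsto:
  assumes P_L2: "P \<subseteq> L2_space law"
    and cone: "\<And>a g. g \<in> P \<Longrightarrow> (\<lambda>x. a * g x) \<in> P"
    and \<nu>: "0 < \<nu>" "\<nu> < 1 / L"
    and run: "boosting_run M law X Y \<xi> P \<nu> F f"
  shows "(\<lambda>t. risk M X Y \<psi> (F t)) \<longlonglongrightarrow> (INF G\<in>lin P. risk M X Y \<psi> G)"
proof -
  define a where "a = (\<lambda>t. L2_norm law (f (Suc t)))"
  have step: "F (Suc t) = (\<lambda>x. F t x + \<nu> * f (Suc t) x)" for t
    using run by (simp add: boosting_run_def)
  have min: "is_arg_min (boosting_objective M law X Y \<xi> (F t)) (\<lambda>g. g \<in> P) (f (Suc t))" for t
    using run by (simp add: boosting_run_def)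
  then have f_P: "f (Suc t) \<in> P" for t by (simp add: is_arg_min_def)
  have F0_P: "F 0 \<in> P" using run by (simp add: boosting_run_def)
  have F_lin: "F t \<in> lin P" for t
  proof (induction t)
    case 0
    show ?case using F0_P by (rule subset_lin)
  next
    case (Suc t)
    then show ?case unfolding step using f_P by (intro lin_add_scaled)
  qed
  have lin_L2: "lin P \<subseteq> L2_space law"
    using P_L2 unfolding lin_def by (auto intro!: L2_space_sum)
  have F_L2: "F t \<in> L2_space law" for t using F_lin lin_L2 by blast
  note optimality = weak_learner_optimality[OF cone min, folded a_def]
  have opt_f: "score (F t) (f (Suc t)) = - (a t)\<^sup>2" for t
    using optimality(1)[of t] by (simp add: a_def)
  have opt_P: "\<bar>score (F t) g\<bar> \<le> L2_norm law g * a t" if "g \<in> P" for g t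
    using optimality(2)[OF _ that, of t] by (simp add: a_def)
  have a_nonneg: "0 \<le> a t" for t by (simp add: a_def L2_norm_nonneg)

  define \<kappa> where "\<kappa> = \<nu> * (1 - \<nu> * L)"
  have "\<kappa> > 0" using \<nu> L_pos by (simp add: \<kappa>_def field_simps)
  have descent: "mean_loss (F (Suc t)) \<le> mean_loss (F t) - \<kappa> * (a t)\<^sup>2" for t
  proof -
    have "mean_loss (F (Suc t)) \<le> mean_loss (F t) + \<nu> * - (a t)\<^sup>2 + \<nu>\<^sup>2 * L * (a t)\<^sup>2"
      using mean_loss_descent[OF F_L2, of "f (Suc t)" t \<nu>] f_P P_L2
      by (auto simp: step opt_f a_def)
    then show ?thesis by (simp add: \<kappa>_def algebra_simps power2_eq_square)
  qed
  \<comment> \<open>The total decrease of the risk is finite, hence so is the sum of the squared norms.\<close>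
  have sums: "\<kappa> * (\<Sum>s<n. (a s)\<^sup>2) \<le> mean_loss (F 0) - mean_loss (F n)" for n
  proof (induction n)
    case (Suc n)
    then show ?case using descent[of n] by (simp add: distrib_left)
  qed simp
  have summable: "summable (\<lambda>t. (a t)\<^sup>2)"
  proof (rule bounded_imp_summable)
    fix n
    have "\<kappa> * (\<Sum>s<Suc n. (a s)\<^sup>2) \<le> mean_loss (F 0)"
      using sums[of "Suc n"] mean_loss_nonneg[of "F (Suc n)"] by linarith
    then show "(\<Sum>s\<le>n. (a s)\<^sup>2) \<le> mean_loss (F 0) / \<kappa>"
      using \<open>\<kappa> > 0\<close> by (simp add: pos_le_divide_eq mult.commute lessThan_Suc_atMost)
  qed simp

  \<comment> \<open>An iterate is \<open>F 0\<close> plus \<open>\<nu>\<close> times the weak learners chosen so far, all of them in \<open>P\<close>.\<close>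
  have score_iterate: "\<bar>score (F t) (F s)\<bar> \<le> a t * (L2_norm law (F 0) + \<nu> * (\<Sum>r<s. a r))" for t s
  proof (induction s)
    case 0
    show ?case using opt_P[OF F0_P] by (simp add: mult.commute)
  next
    case (Suc s)
    have "f (Suc s) \<in> L2_space law" using f_P P_L2 by blast
    then have "score (F t) (F (Suc s)) = score (F t) (F s) + \<nu> * score (F t) (f (Suc s))"
      by (simp add: step score_add[OF F_L2 F_L2 L2_space_scale] score_scale)
    then have "\<bar>score (F t) (F (Suc s))\<bar>
        \<le> \<bar>score (F t) (F s)\<bar> + \<nu> * \<bar>score (F t) (f (Suc s))\<bar>"
      using \<nu> abs_triangle_ineq[of "score (F t) (F s)" "\<nu> * score (F t) (f (Suc s))"]
      by (simp add: abs_mult)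
    moreover have "\<nu> * \<bar>score (F t) (f (Suc s))\<bar> \<le> \<nu> * (a s * a t)"
      using opt_P[OF f_P[of s], of t] \<nu> unfolding a_def by (intro mult_left_mono) simp_all
    ultimately show ?case using Suc by (simp add: algebra_simps)
  qed

  have le: "(INF t. risk M X Y \<psi> (F t)) \<le> risk M X Y \<psi> G" if G: "G \<in> lin P" for G
  proof (rule ennreal_le_epsilon)
    fix \<epsilon> :: real assume "0 < \<epsilon>"
    obtain n :: nat and c g where g: "\<forall>i<n. g i \<in> P" and G_eq: "G = (\<lambda>x. \<Sum>i<n. c i * g i x)"
      using G unfolding lin_def by blast
    have G_L2: "G \<in> L2_space law" using G lin_L2 by blast
    define K where "K = (\<Sum>i<n. \<bar>c i\<bar> * L2_norm law (g i))"
    have "K \<ge> 0" unfolding K_def by (intro sum_nonneg mult_nonneg_nonneg) (auto simp: L2_norm_nonneg)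
    have score_G: "\<bar>score (F t) G\<bar> \<le> a t * K" for t
    proof -
      have "score (F t) G = (\<Sum>i<n. c i * score (F t) (g i))"
        unfolding G_eq using g P_L2 by (intro score_sum F_L2) auto
      also have "\<bar>\<dots>\<bar> \<le> (\<Sum>i<n. \<bar>c i\<bar> * (L2_norm law (g i) * a t))"
        using g opt_P by (intro order_trans[OF sum_abs] sum_mono) (auto simp: abs_mult intro: mult_left_mono)
      finally show ?thesis by (simp add: K_def sum_distrib_left mult_ac)
    qed
    obtain t where t: "a t * (K + L2_norm law (F 0) + \<nu> * (\<Sum>s<t. a s)) < \<epsilon>"
      using square_summable_times_partial_sums_small[OF a_nonneg summable, of "K + L2_norm law (F 0)" \<nu> \<epsilon> 0]
        \<open>0 < \<epsilon>\<close> \<open>K \<ge> 0\<close> \<nu> L2_norm_nonneg[of law "F 0"] by auto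
    have "mean_loss (F t) + (score (F t) G - score (F t) (F t)) \<le> mean_loss G"
      using mean_loss_above_tangent[OF F_L2 G_L2, of t] score_diff[OF F_L2 G_L2 F_L2] by simp
    then have "mean_loss (F t) \<le> mean_loss G + \<epsilon>"
      using score_G[of t] score_iterate[of t t] t by (simp add: algebra_simps abs_le_iff)
    then have "risk M X Y \<psi> (F t) \<le> risk M X Y \<psi> G + ennreal \<epsilon>"
      using \<open>0 < \<epsilon>\<close> mean_loss_nonneg
      by (simp add: risk_eq_mean_loss F_L2 G_L2 ennreal_plus[symmetric] ennreal_leI del: ennreal_plus)
    then show "(INF t. risk M X Y \<psi> (F t)) \<le> risk M X Y \<psi> G + ennreal \<epsilon>"
      by (rule INF_lower2[OF UNIV_I])
  qed
  have "decseq (\<lambda>t. risk M X Y \<psi> (F t))"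
  proof (rule decseq_SucI)
    fix t
    have "0 \<le> \<kappa> * (a t)\<^sup>2" using \<open>\<kappa> > 0\<close> by simp
    then show "risk M X Y \<psi> (F (Suc t)) \<le> risk M X Y \<psi> (F t)"
      using descent[of t] by (simp add: risk_eq_mean_loss F_L2 ennreal_leI)
  qed
  then have "(\<lambda>t. risk M X Y \<psi> (F t)) \<longlonglongrightarrow> (INF t. risk M X Y \<psi> (F t))"
    by (rule LIMSEQ_INF)
  also have "(INF t. risk M X Y \<psi> (F t)) = (INF G\<in>lin P. risk M X Y \<psi> G)"
  proof (rule antisym)
    show "(INF t. risk M X Y \<psi> (F t)) \<le> (INF G\<in>lin P. risk M X Y \<psi> G)"
      using le by (intro INF_greatest)
    show "(INF G\<in>lin P. risk M X Y \<psi> G) \<le> (INF t. risk M X Y \<psi> (F t))"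
      using F_lin by (intro INF_greatest INF_lower) auto
  qed
  finally show ?thesis .
qed

end

theorem theorem3p2:
  fixes M :: "'w measure"
    and XX :: "(real ^ 'd) set" and YY :: "real set"
    and X :: "'w \<Rightarrow> real ^ 'd" and Y :: "'w \<Rightarrow> real"
    and \<mu>X :: "(real ^ 'd) measure"
    and \<psi> \<xi> :: "real \<Rightarrow> real \<Rightarrow> real"
    and P :: "(real ^ 'd \<Rightarrow> real) set"
    and F f :: "nat \<Rightarrow> real ^ 'd \<Rightarrow> real"
    and L \<nu> :: real
  assumes prob: "prob_space M"
    and XX: "XX \<in> sets borel"
    and X: "X \<in> measurable M (restrict_space borel XX)"
    and Y: "Y \<in> measurable M (restrict_space borel YY)"
    and \<mu>X: "\<mu>X = distr M (restrict_space borel XX) X"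
    and \<psi>_nonneg: "\<forall>x. \<forall>y\<in>YY. 0 \<le> \<psi> x y"
    and \<psi>_meas: "(\<lambda>(x, y). \<psi> x y) \<in> borel_measurable (borel \<Otimes>\<^sub>M restrict_space borel YY)"
    and \<psi>_convex: "\<forall>y\<in>YY. convex_on UNIV (\<lambda>x. \<psi> x y)"
    and \<xi>_meas: "(\<lambda>(x, y). \<xi> x y) \<in> borel_measurable (borel \<Otimes>\<^sub>M restrict_space borel YY)"
    and \<xi>_subgrad: "\<forall>x. \<forall>y\<in>YY. \<xi> x y \<in> {left_deriv (\<lambda>u. \<psi> u y) x .. right_deriv (\<lambda>u. \<psi> u y) x}"
    and P_L2: "P \<subseteq> L2_space \<mu>X"
    and P_nonempty: "P \<noteq> {}"
    and P_sym: "\<forall>g. g \<in> P \<longleftrightarrow> (\<lambda>x. - g x) \<in> P"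
    and P_cone: "\<forall>a. \<forall>g\<in>P. (\<lambda>x. a * g x) \<in> P"
    and risk0: "(\<integral>\<^sup>+\<omega>. ennreal (\<psi> 0 (Y \<omega>)) \<partial>M) < \<infinity>"
    and deriv_locally_bounded:
      "\<forall>F0\<in>L2_space \<mu>X. \<exists>\<delta>>0.
         (SUP G\<in>{G \<in> L2_space \<mu>X. L2_norm \<mu>X (\<lambda>x. G x - F0 x) \<le> \<delta>}.
            (\<integral>\<^sup>+\<omega>. ennreal (\<bar>left_deriv (\<lambda>u. \<psi> u (Y \<omega>)) (G (X \<omega>))\<bar>\<^sup>2) \<partial>M) +
            (\<integral>\<^sup>+\<omega>. ennreal (\<bar>right_deriv (\<lambda>u. \<psi> u (Y \<omega>)) (G (X \<omega>))\<bar>\<^sup>2) \<partial>M)) < \<infinity>"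
    and strong: "\<exists>\<alpha>>0. \<forall>y\<in>YY. strongly_convex \<alpha> (\<lambda>x. \<psi> x y)"
    and L_pos: "0 < L"
    and cond_lipschitz:
      "\<forall>x1 x2. AE \<omega> in M.
         \<bar>real_cond_exp M (vimage_algebra (space M) X (restrict_space borel XX))
            (\<lambda>\<omega>. \<xi> x1 (Y \<omega>) - \<xi> x2 (Y \<omega>)) \<omega>\<bar> \<le> L * \<bar>x1 - x2\<bar>"
    and \<nu>: "0 < \<nu>" "\<nu> < 1 / (2 * L)"
    and run: "boosting_run M \<mu>X X Y \<xi> P \<nu> F f"
  shows "(\<lambda>t. risk M X Y \<psi> (F t)) \<longlonglongrightarrow> (INF G\<in>lin P. risk M X Y \<psi> G)"
proof -
  interpret convex_boosting M "restrict_space borel XX" X YY Y \<psi> \<xi> L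
  proof (intro convex_boosting.intro convex_boosting_axioms.intro prob)
    fix G assume G: "G \<in> L2_space (distr M (restrict_space borel XX) X)"
    obtain \<delta> where \<delta>: "\<delta> > 0"
      "(SUP H\<in>{H \<in> L2_space \<mu>X. L2_norm \<mu>X (\<lambda>x. H x - G x) \<le> \<delta>}.
         (\<integral>\<^sup>+\<omega>. ennreal (\<bar>left_deriv (\<lambda>u. \<psi> u (Y \<omega>)) (H (X \<omega>))\<bar>\<^sup>2) \<partial>M) +
         (\<integral>\<^sup>+\<omega>. ennreal (\<bar>right_deriv (\<lambda>u. \<psi> u (Y \<omega>)) (H (X \<omega>))\<bar>\<^sup>2) \<partial>M)) < \<infinity>"
      using deriv_locally_bounded G unfolding \<mu>X by blast
    have "G \<in> {H \<in> L2_space \<mu>X. L2_norm \<mu>X (\<lambda>x. H x - G x) \<le> \<delta>}"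
      using G \<delta>(1) by (simp add: \<mu>X L2_norm_def)
    from le_less_trans[OF SUP_upper[OF this] \<delta>(2)]
    show "(\<integral>\<^sup>+\<omega>. ennreal (\<bar>left_deriv (\<lambda>u. \<psi> u (Y \<omega>)) (G (X \<omega>))\<bar>\<^sup>2) \<partial>M) +
      (\<integral>\<^sup>+\<omega>. ennreal (\<bar>right_deriv (\<lambda>u. \<psi> u (Y \<omega>)) (G (X \<omega>))\<bar>\<^sup>2) \<partial>M) < \<infinity>" .
  qed (use X Y \<psi>_nonneg \<psi>_meas \<psi>_convex \<xi>_meas \<xi>_subgrad risk0 cond_lipschitz L_pos in auto)
  have "1 / (2 * L) \<le> 1 / L" using L_pos by (simp add: field_simps)
  with \<nu> have "\<nu> < 1 / L" by simp
  then show ?thesis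
    using P_L2 P_cone \<nu>(1) run unfolding \<mu>X by (intro boosting_risk_tendsto) auto
qed

end
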